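(* Let $(S_1,m_1),\dots,(S_n,m_n)$ be finite multisets of elements of a field $\mathbb{F}$, and let $S=S_1\times\cdots\times S_n$. Suppose that $0\in S_i$ with $m_i(0)=1$ for every $i$, and that $H_1,\dots,H_k$ are hyperplanes in $\mathbb{F}^n$ such that every point $\mathbf{s}\in S\setminus\{\mathbf{0}\}$ is covered by at least $|m(\mathbf{s})|-n+1$ of the hyperplanes, and the point $\mathbf{0}$ is not covered by any of the hyperplanes. Then $$k\ge d(S_1)+d(S_2)+\cdots+d(S_n)-n.$$
   Context: A finite multiset $(S_i,m_i)$ of elements of $\mathbb{F}$ is a finite subset $S_i\subseteq\mathbb{F}$ together with a positive integer multiplicity $m_i(s)$ for each $s\in S_i$. Its size is $d(S_i)=\sum_{s\in S_i}m_i(s)$. For $\mathbf{s}=(s_1,\dots,s_n)\in S$ put $|m(\mathbf{s})|=m_1(s_1)+\cdots+m_n(s_n)$. Hyperplanes are affine hyperplanes, i.e. zero sets of polynomials of degree exactly one in $\mathbb{F}[x_1,\dots,x_n]$. $H_1,\dots,H_k$ is a list in which repetitions are allowed, and the number of hyperplanes covering $\mathbf{s}$ is the number of indices $j$ with $\mathbf{s}\in H_j$. *)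

theory Defs
  imports "HOL-Analysis.Finite_Cartesian_Product" "HOL-Library.Multiset"
begin

text \<open>
  A polynomial of degree exactly one is \<open>a 1 * x 1 + \<dots> + a n * x n + c\<close> with coefficients
  \<open>a i\<close> not all zero.
\<close>
definition affine_hyperplane :: "('a::field ^ 'n::finite) set \<Rightarrow> bool" where
  "affine_hyperplane H \<longleftrightarrow>
     (\<exists>a c. a \<noteq> 0 \<and> H = {x. (\<Sum>i\<in>UNIV. a $ i * x $ i) + c = 0})"

text \<open>
  A finite set with positive integer multiplicities is a library multiset: the multiplicity of
  \<open>s\<close> in the \<open>i\<close>-th factor is \<open>count (S i) s\<close>, and the cardinality counted with multiplicity
  is \<open>size (S i)\<close>.
\<close>
definition grid :: "('n::finite \<Rightarrow> 'a multiset) \<Rightarrow> ('a ^ 'n) set" where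
  "grid S = {s. \<forall>i. s $ i \<in># S i}"

definition total_mult :: "('n::finite \<Rightarrow> 'a multiset) \<Rightarrow> 'a ^ 'n \<Rightarrow> nat" where
  "total_mult S s = (\<Sum>i\<in>UNIV. count (S i) (s $ i))"

definition cover_count :: "'b set list \<Rightarrow> 'b \<Rightarrow> nat" where
  "cover_count Hs s = card {j. j < length Hs \<and> s \<in> Hs ! j}"

end

theory Submission imports Defs begin

text \<open>
  Let \<open>P\<close> be the product of the \<open>k\<close> affine forms whose zero sets are the hyperplanes, and let
  \<open>L\<close> be the tensor product over \<open>i\<close> of the divided difference functionals
  \<open>f \<mapsto> f[S i]\<close>, where nodes are repeated according to their multiplicities.  The theorem follows
  by evaluating \<open>L P\<close> in two ways.

  A divided difference over \<open>d\<close> nodes annihilates polynomials of degree less than \<open>d - 1\<close>. Every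
  monomial of degree less than \<open>\<Sum>i. (d (S i) - 1)\<close> has some exponent below \<open>d (S i) - 1\<close>, so
  \<open>L P = 0\<close> if \<open>k\<close> is too small (\<open>divided_difference_low_degree\<close>).

  On the other hand, the recurrence \<open>(s - t) f[s,t,u] = f[s,u] - f[t,u]\<close> expresses \<open>L\<close> by
  functionals on smaller grids, and in the end by functionals supported at a single grid point.
  At a point \<open>s\<close> these involve only Hasse derivatives of order at most \<open>|m(s)| - n\<close>, which vanish on \<open>P\<close>
  as soon as \<open>|m(s)| - n + 1\<close> of its factors vanish at \<open>s\<close>
  (\<open>divided_difference_eq_0_if_covered\<close>).  Only the origin survives. As it has multiplicity one in
  each direction, its contribution is a nonzero multiple of the value \<open>P(0) \<noteq> 0\<close>
  (\<open>divided_difference_neq_0_if_punctured\<close>). Hence \<open>L P \<noteq> 0\<close>.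

  Only the values of \<open>L\<close> on products of affine forms occur. By the Leibniz rule these values obey a
  recursion on the list of factors, which serves as the definition here, so that polynomials in
  several variables never have to be constructed.
\<close>

section \<open>Divided differences of products of affine forms\<close>

definition affine_value :: "('n::finite \<Rightarrow> 'a::field) \<times> 'a \<Rightarrow> ('n \<Rightarrow> 'a) \<Rightarrow> 'a" where
  "affine_value l x = (\<Sum>i\<in>UNIV. fst l i * x i) + snd l"

text \<open>
  The iterated divided difference, in direction \<open>i\<close> with nodes \<open>T i\<close>, of the product of the affine
  forms \<open>ls\<close>.  The second equation is the Leibniz rule
  \<open>(x f)[s,u] = s * f[s,u] + f[u]\<close> applied in each direction; it is consistent with setting the
  divided difference over an empty list of nodes to \<open>0\<close>.
\<close>

primrec divided_difference ::
    "(('n::finite \<Rightarrow> 'a::field) \<times> 'a) list \<Rightarrow> ('n \<Rightarrow> 'a list) \<Rightarrow> 'a" where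
  "divided_difference [] T = (if \<forall>i. length (T i) = 1 then 1 else 0)"
| "divided_difference (l # ls) T =
    (if \<exists>i. T i = [] then 0
     else affine_value l (\<lambda>i. hd (T i)) * divided_difference ls T
        + (\<Sum>i\<in>UNIV. fst l i * divided_difference ls (T(i := tl (T i)))))"

lemma divided_difference_empty:
  assumes "T i = []"
  shows "divided_difference ls T = 0"
  using assms by (cases ls) (auto intro!: exI[of _ i])

lemma sum_length_update:
  fixes T :: "'n::finite \<Rightarrow> 'a list"
  shows "(\<Sum>j\<in>UNIV. length ((T(i := v)) j)) + length (T i) = (\<Sum>j\<in>UNIV. length (T j)) + length v"
proof -
  have "(\<Sum>j\<in>UNIV - {i}. length ((T(i := v)) j)) = (\<Sum>j\<in>UNIV - {i}. length (T j))"
    by (rule sum.cong) auto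
  then show ?thesis
    by (simp add: sum.remove[of UNIV i])
qed

lemma sum_length_tl:
  fixes T :: "'n::finite \<Rightarrow> 'a list"
  assumes "T i \<noteq> []"
  shows "Suc (\<Sum>j\<in>UNIV. length ((T(i := tl (T i))) j)) = (\<Sum>j\<in>UNIV. length (T j))"
proof -
  have "Suc (length (tl (T i))) = length (T i)"
    using assms by (cases "T i") auto
  then show ?thesis
    using sum_length_update[of T i "tl (T i)"] by linarith
qed

text \<open>
  Each factor can shorten only one of the node lists, and all of them must shrink to length one for
  a nonzero contribution.
\<close>

lemma divided_difference_low_degree:
  fixes T :: "'n::finite \<Rightarrow> 'a::field list"
  assumes "length ls + CARD('n) < (\<Sum>i\<in>UNIV. length (T i))"
  shows "divided_difference ls T = 0"
  using assms
proof (induction ls arbitrary: T)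
  case Nil
  have "\<not> (\<forall>i. length (T i) = 1)"
  proof
    assume "\<forall>i. length (T i) = 1"
    then have "(\<Sum>i\<in>UNIV. length (T i)) = CARD('n)"
      by simp
    then show False
      using Nil by simp
  qed
  then show ?case
    by (simp only: divided_difference.simps if_False)
next
  case (Cons l ls)
  show ?case
  proof (cases "\<exists>i. T i = []")
    case False
    have "divided_difference ls (T(i := tl (T i))) = 0" for i
      using sum_length_tl[of T i] False Cons.prems by (intro Cons.IH) auto
    moreover have "divided_difference ls T = 0"
      using Cons.prems by (intro Cons.IH) auto
    ultimately show ?thesis
      by simp
  qed simp
qed

section \<open>The recurrence and the symmetry in the nodes\<close>

text \<open>
  The recurrence of Newton's divided differences. It passes from \<open>ls\<close> to \<open>l # ls\<close> because replacing
  the leading node \<open>s\<close> of direction \<open>i\<close> by \<open>t\<close> changes the value of \<open>l\<close> by exactly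
  \<open>fst l i * (s - t)\<close>.
\<close>

lemma divided_difference_recurrence:
  fixes T :: "'n::finite \<Rightarrow> 'a::field list"
  shows "(s - t) * divided_difference ls (T(i := s # t # u))
    = divided_difference ls (T(i := s # u)) - divided_difference ls (T(i := t # u))"
proof (induction ls arbitrary: T u)
  case Nil
  have "\<not> (\<forall>j. length ((T(i := s # t # u)) j) = 1)"
    by (auto intro!: exI[of _ i])
  moreover have "(\<forall>j. length ((T(i := s # u)) j) = 1) \<longleftrightarrow> (\<forall>j. length ((T(i := t # u)) j) = 1)"
    by auto
  ultimately show ?case
    by (simp only: divided_difference.simps) simp
next
  case (Cons l ls)
  show ?case
  proof (cases "\<exists>j. j \<noteq> i \<and> T j = []")
    case True
    then obtain j where j: "j \<noteq> i" "T j = []"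
      by blast
    then have "divided_difference (l # ls) (T(i := v)) = 0" for v
      by (intro divided_difference_empty[of _ j]) simp
    then show ?thesis
      by (simp only:) simp
  next
    case False
    define V where "V v = affine_value l (\<lambda>j. hd ((T(i := v)) j))" for v
    \<comment> \<open>the contribution of the directions other than \<open>i\<close> to the Leibniz rule\<close>
    define R where "R v = (\<Sum>j\<in>UNIV - {i}. fst l j *
        divided_difference ls ((T(j := tl (T j)))(i := v)))" for v
    have expand: "divided_difference (l # ls) (T(i := x # v)) =
        V (x # v) * divided_difference ls (T(i := x # v))
        + (fst l i * divided_difference ls (T(i := v)) + R (x # v))" for x v
    proof -
      have "(\<Sum>j\<in>UNIV - {i}. fst l j * divided_difference ls
            ((T(i := x # v))(j := tl ((T(i := x # v)) j)))) = R (x # v)"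
        unfolding R_def by (rule sum.cong) (auto simp: fun_upd_twist)
      moreover have "\<not> (\<exists>j. (T(i := x # v)) j = [])"
        using False by auto
      ultimately show ?thesis
        by (simp add: V_def sum.remove[of UNIV i])
    qed
    have V_head: "V (x # v) = fst l i * x + ((\<Sum>j\<in>UNIV - {i}. fst l j * hd (T j)) + snd l)" for x v
    proof -
      have "(\<Sum>j\<in>UNIV - {i}. fst l j * hd ((T(i := x # v)) j))
          = (\<Sum>j\<in>UNIV - {i}. fst l j * hd (T j))"
        by (rule sum.cong) auto
      then show ?thesis
        by (simp add: V_def affine_value_def sum.remove[of UNIV i])
    qed
    have V_shift: "V (s # t # u) = V (s # u)" "V (t # u) = V (s # u) - fst l i * (s - t)"
      unfolding V_head by (simp_all add: algebra_simps)
    have R_rec: "(s - t) * R (s # t # u) = R (s # u) - R (t # u)"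
      unfolding R_def sum_distrib_left sum_subtractf[symmetric]
    proof (rule sum.cong[OF refl])
      fix j
      show "(s - t) * (fst l j * divided_difference ls ((T(j := tl (T j)))(i := s # t # u)))
          = fst l j * divided_difference ls ((T(j := tl (T j)))(i := s # u))
            - fst l j * divided_difference ls ((T(j := tl (T j)))(i := t # u))"
        using Cons.IH[of "T(j := tl (T j))" u] by (metis mult.left_commute right_diff_distrib)
    qed
    have "(s - t) * divided_difference (l # ls) (T(i := s # t # u))
        = V (s # u) * ((s - t) * divided_difference ls (T(i := s # t # u)))
          + (fst l i * (s - t) * divided_difference ls (T(i := t # u))
          + (s - t) * R (s # t # u))"
      unfolding expand V_shift(1) by (simp add: algebra_simps)
    also have "\<dots> = divided_difference (l # ls) (T(i := s # u))
        - divided_difference (l # ls) (T(i := t # u))"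
      unfolding expand V_shift(2) R_rec Cons.IH by (simp add: algebra_simps)
    finally show ?thesis .
  qed
qed

lemma divided_difference_swap:
  "divided_difference ls (T(i := s # t # u)) = divided_difference ls (T(i := t # s # u))"
proof (cases "s = t")
  case False
  have "(s - t) * divided_difference ls (T(i := t # s # u))
      = - ((t - s) * divided_difference ls (T(i := t # s # u)))"
    by (simp add: algebra_simps)
  also have "\<dots> = (s - t) * divided_difference ls (T(i := s # t # u))"
    unfolding divided_difference_recurrence by simp
  finally show ?thesis
    using False by simp
qed simp

text \<open>
  Node lists with the same head are handled by the Leibniz rule and the induction hypothesis, and
  \<open>divided_difference_swap\<close> brings any other node to the head.
\<close>

lemma divided_difference_mset_cong:
  fixes T :: "'n::finite \<Rightarrow> 'a::field list"
  assumes "mset v = mset w"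
  shows "divided_difference ls (T(i := v)) = divided_difference ls (T(i := w))"
  using assms
proof (induction ls arbitrary: T v w)
  case Nil
  then have "length v = length w"
    by (rule mset_eq_length)
  then show ?case
    by auto
next
  case (Cons l ls)
  have same_head: "divided_difference (l # ls) (T(i := x # v)) =
      divided_difference (l # ls) (T(i := x # w))" if vw: "mset v = mset w" for x v w
  proof -
    have heads: "hd ((T(i := x # v)) j) = hd ((T(i := x # w)) j)" for j
      by auto
    have empties: "(\<exists>j. (T(i := x # v)) j = []) \<longleftrightarrow> (\<exists>j. (T(i := x # w)) j = [])"
      by auto
    have whole: "divided_difference ls (T(i := x # v)) = divided_difference ls (T(i := x # w))"
      using vw by (intro Cons.IH) simp
    have tails: "divided_difference ls ((T(i := x # v))(j := tl ((T(i := x # v)) j)))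
        = divided_difference ls ((T(i := x # w))(j := tl ((T(i := x # w)) j)))" for j
    proof (cases "j = i")
      case True
      then show ?thesis
        using Cons.IH[OF vw, of T] by (simp only: fun_upd_same fun_upd_upd list.sel)
    next
      case False
      have "mset (x # v) = mset (x # w)"
        using vw by simp
      then have "divided_difference ls ((T(j := tl (T j)))(i := x # v))
          = divided_difference ls ((T(j := tl (T j)))(i := x # w))"
        by (rule Cons.IH)
      moreover have "(T(i := x # y))(j := tl ((T(i := x # y)) j)) = (T(j := tl (T j)))(i := x # y)"
        for y
        using False by auto
      ultimately show ?thesis
        by (simp only:)
    qed
    show ?thesis
      by (simp only: divided_difference.simps heads empties whole tails)
  qed
  show ?case
  proof (cases v)
    case Nil
    then show ?thesis
      using Cons.prems by simp
  next
    case v: (Cons s v')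
    obtain t w' where w: "w = t # w'"
      using Cons.prems v by (cases w) auto
    show ?thesis
    proof (cases "s = t")
      case True
      then show ?thesis
        using Cons.prems v w by (simp only:) (intro same_head, simp)
    next
      case False
      then have "t \<in># mset v'"
        using Cons.prems v w by (metis insert_noteq_member mset.simps(2))
      then obtain u where v': "mset v' = mset (t # u)"
        by (metis ex_mset mset.simps(2) mset_add)
      then have w': "mset (s # u) = mset w'"
        using Cons.prems v w by simp
      have "divided_difference (l # ls) (T(i := s # v'))
          = divided_difference (l # ls) (T(i := s # t # u))"
        by (rule same_head[OF v'])
      also have "\<dots> = divided_difference (l # ls) (T(i := t # s # u))"
        by (rule divided_difference_swap)
      also have "\<dots> = divided_difference (l # ls) (T(i := t # w'))"
        by (rule same_head[OF w'])
      finally show ?thesis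
        by (simp only: v w)
    qed
  qed
qed

text \<open>Hence the recurrence applies to any two nodes, wherever they occur in the list.\<close>

lemma divided_difference_recurrence_mset:
  fixes T :: "'n::finite \<Rightarrow> 'a::field list"
  assumes "mset (T i) = mset (s # t # u)"
  shows "(s - t) * divided_difference ls T
    = divided_difference ls (T(i := s # u)) - divided_difference ls (T(i := t # u))"
proof -
  have "divided_difference ls T = divided_difference ls (T(i := s # t # u))"
    using divided_difference_mset_cong[OF assms, of ls T i] by (simp only: fun_upd_triv)
  then show ?thesis
    by (simp only: divided_difference_recurrence)
qed

section \<open>Covering conditions\<close>

text \<open>
  The inequality says \<open>|m(x)| - n + 1 \<le> (number of forms vanishing at x)\<close> for the multiplicities
  in the node lists \<open>T\<close>, rearranged to avoid subtraction.
\<close>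

definition sufficiently_covered ::
    "(('n::finite \<Rightarrow> 'a::field) \<times> 'a) list \<Rightarrow> ('n \<Rightarrow> 'a list) \<Rightarrow> ('n \<Rightarrow> 'a) \<Rightarrow> bool" where
  "sufficiently_covered ls T x \<longleftrightarrow>
     (\<Sum>i\<in>UNIV. count (mset (T i)) (x i))
       < length (filter (\<lambda>l. affine_value l x = 0) ls) + CARD('n)"

lemma sufficiently_covered_update:
  fixes T :: "'n::finite \<Rightarrow> 'a::field list"
  assumes "sufficiently_covered ls T x" "mset v \<subseteq># mset (T i)"
  shows "sufficiently_covered ls (T(i := v)) x"
proof -
  have "(\<Sum>j\<in>UNIV. count (mset ((T(i := v)) j)) (x j)) \<le> (\<Sum>j\<in>UNIV. count (mset (T j)) (x j))"
    using assms(2) by (intro sum_mono) (auto simp: mset_subset_eq_count)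
  then show ?thesis
    using assms(1) unfolding sufficiently_covered_def by linarith
qed

text \<open>
  For nodes concentrated at the single point \<open>x\<close>, a factor that vanishes at \<open>x\<close> must shorten one
  of the node lists, and there are not enough nodes for all these factors.
\<close>

lemma divided_difference_eq_0_at_point:
  fixes T :: "'n::finite \<Rightarrow> 'a::field list"
  assumes "\<And>i. set (T i) \<subseteq> {x i}"
    and "(\<Sum>i\<in>UNIV. length (T i)) < length (filter (\<lambda>l. affine_value l x = 0) ls) + CARD('n)"
  shows "divided_difference ls T = 0"
  using assms
proof (induction ls arbitrary: T)
  case Nil
  have "\<not> (\<forall>i. length (T i) = 1)"
  proof
    assume "\<forall>i. length (T i) = 1"
    then have "(\<Sum>i\<in>UNIV. length (T i)) = CARD('n)"
      by simp
    then show False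
      using Nil by simp
  qed
  then show ?case
    by (simp only: divided_difference.simps if_False)
next
  case (Cons l ls)
  show ?case
  proof (cases "\<exists>i. T i = []")
    case False
    have head: "(\<lambda>i. hd (T i)) = x"
    proof
      fix i
      show "hd (T i) = x i"
        using False Cons.prems(1)[of i] list.set_sel(1)[of "T i"] by blast
    qed
    have tails: "divided_difference ls (T(i := tl (T i))) = 0" for i
    proof (rule Cons.IH)
      show "set ((T(i := tl (T i))) j) \<subseteq> {x j}" for j
        using Cons.prems(1)[of j] False list.set_sel(2)[of "T i"] by (auto simp: subset_iff)
      show "(\<Sum>j\<in>UNIV. length ((T(i := tl (T i))) j))
          < length (filter (\<lambda>l. affine_value l x = 0) ls) + CARD('n)"
        using sum_length_tl[of T i] False Cons.prems(2) by (auto split: if_splits)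
    qed
    have "affine_value l x * divided_difference ls T = 0"
    proof (cases "affine_value l x = 0")
      case False
      then have "divided_difference ls T = 0"
        using Cons.prems by (intro Cons.IH) auto
      then show ?thesis
        by simp
    qed simp
    then show ?thesis
      by (simp add: head tails)
  qed simp
qed

text \<open>
  As long as some direction has two distinct nodes, the recurrence reduces the claim to two smaller
  grids, on which multiplicities are no larger, so that the covering condition is inherited.
\<close>

lemma divided_difference_eq_0_if_covered:
  fixes T :: "'n::finite \<Rightarrow> 'a::field list"
  assumes "\<And>x. (\<And>i. x i \<in> set (T i)) \<Longrightarrow> sufficiently_covered ls T x"
  shows "divided_difference ls T = 0"
  using assms
proof (induction "\<Sum>i\<in>UNIV. length (T i)" arbitrary: T rule: less_induct)
  case less
  consider (empty) i where "T i = []"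
    | (two) i s t where "s \<in> set (T i)" "t \<in> set (T i)" "s \<noteq> t"
    | (point) "\<And>i. T i \<noteq> []" "\<And>i s t. s \<in> set (T i) \<Longrightarrow> t \<in> set (T i) \<Longrightarrow> s = t"
    by blast
  then show ?case
  proof cases
    case empty
    then show ?thesis
      by (rule divided_difference_empty)
  next
    case two
    then obtain u where u: "mset (T i) = mset (s # t # u)"
      by (metis ex_mset insert_noteq_member mset.simps(2) multi_member_split set_mset_mset)
    have sub: "divided_difference ls (T(i := v)) = 0"
      if v: "mset v \<subseteq># mset (T i)" "length v < length (T i)" for v
    proof (rule less.hyps)
      show "(\<Sum>j\<in>UNIV. length ((T(i := v)) j)) < (\<Sum>j\<in>UNIV. length (T j))"
        using sum_length_update[of T i v] v(2) by linarith
      fix x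
      assume x: "\<And>j. x j \<in> set ((T(i := v)) j)"
      have "x j \<in> set (T j)" for j
        using x[of j] v(1) by (auto split: if_splits dest: mset_subset_eqD)
      then show "sufficiently_covered ls (T(i := v)) x"
        using less.prems v(1) by (intro sufficiently_covered_update) auto
    qed
    have "length (T i) = length (s # t # u)"
      using u by (rule mset_eq_length)
    then have "divided_difference ls (T(i := s # u)) = 0" "divided_difference ls (T(i := t # u)) = 0"
      by (auto intro!: sub simp: u add_mset_commute[of s t])
    then have "(s - t) * divided_difference ls T = 0"
      using divided_difference_recurrence_mset[of T i, OF u, of ls] by simp
    then show ?thesis
      using two by simp
  next
    case point
    define x where "x i = hd (T i)" for i
    have mem: "x i \<in> set (T i)" for i
      using point(1) by (simp add: x_def)
    have single: "set (T i) \<subseteq> {x i}" for i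
      using point(2) mem by blast
    have "count (mset (T i)) (x i) = length (T i)" for i
    proof -
      have "T i = replicate (length (T i)) (x i)"
        using single[of i] by (intro replicate_eqI) auto
      then show ?thesis
        by (metis count_replicate_mset mset_replicate)
    qed
    then show ?thesis
      using less.prems[OF mem] single
      by (intro divided_difference_eq_0_at_point[of T x]) (auto simp: sufficiently_covered_def)
  qed
qed

lemma divided_difference_singletons:
  "divided_difference ls (\<lambda>i. [x i]) = (\<Prod>l\<leftarrow>ls. affine_value l x)"
proof (induction ls)
  case (Cons l ls)
  have "divided_difference ls ((\<lambda>i. [x i])(i := [])) = 0" for i
    by (rule divided_difference_empty[of _ i]) simp
  then show ?case
    by (simp add: Cons.IH)
qed simp

text \<open>
  The recurrence with the nodes \<open>0\<close> and \<open>t \<noteq> 0\<close> yields one grid without the origin, which is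
  covered and contributes nothing, and one that is again punctured at the origin. Since \<open>0\<close> is a
  simple node, the elimination ends with the value of the product at the origin.
\<close>

lemma divided_difference_neq_0_if_punctured:
  fixes T :: "'n::finite \<Rightarrow> 'a::field list"
  assumes "\<And>i. count (mset (T i)) 0 = 1"
    and "\<And>x. (\<And>i. x i \<in> set (T i)) \<Longrightarrow> x \<noteq> (\<lambda>i. 0) \<Longrightarrow> sufficiently_covered ls T x"
    and "\<And>l. l \<in> set ls \<Longrightarrow> affine_value l (\<lambda>i. 0) \<noteq> 0"
  shows "divided_difference ls T \<noteq> 0"
  using assms(1,2)
proof (induction "\<Sum>i\<in>UNIV. length (T i)" arbitrary: T rule: less_induct)
  case less
  have split0: "\<exists>v. mset (T i) = add_mset 0 (mset v)" for i
    using less.prems(1)[of i]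
    by (metis count_greater_eq_one_iff ex_mset le_refl multi_member_split)
  show ?case
  proof (cases "\<exists>i. \<exists>t \<in> set (T i). t \<noteq> 0")
    case True
    then obtain i t where t: "t \<in> set (T i)" "t \<noteq> 0"
      by blast
    obtain u where u: "mset (T i) = mset (0 # t # u)"
      using split0[of i] t
      by (metis ex_mset insert_noteq_member mset.simps(2) multi_member_split set_mset_mset)
    have len: "length (T i) = length (0 # t # u)"
      using u by (rule mset_eq_length)
    have covered: "sufficiently_covered ls (T(i := v)) x"
      if v: "mset v \<subseteq># mset (T i)" and x: "\<And>j. x j \<in> set ((T(i := v)) j)" "x \<noteq> (\<lambda>j. 0)" for v x
    proof (rule sufficiently_covered_update[OF less.prems(2) v])
      show "x j \<in> set (T j)" for j
        using x(1)[of j] v by (auto split: if_splits dest: mset_subset_eqD)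
    qed (rule x(2))
    have u0: "0 \<notin> set u"
      using less.prems(1)[of i] u t by (auto simp: count_eq_zero_iff split: if_splits)
    have "divided_difference ls (T(i := t # u)) = 0"
    proof (rule divided_difference_eq_0_if_covered)
      fix x
      assume x: "\<And>j. x j \<in> set ((T(i := t # u)) j)"
      have "x i \<noteq> 0"
        using x[of i] u0 t by auto
      then have "x \<noteq> (\<lambda>j. 0)"
        by auto
      then show "sufficiently_covered ls (T(i := t # u)) x"
        using x by (intro covered) (simp_all add: u)
    qed
    moreover have "divided_difference ls (T(i := 0 # u)) \<noteq> 0"
    proof (rule less.hyps)
      show "(\<Sum>j\<in>UNIV. length ((T(i := 0 # u)) j)) < (\<Sum>j\<in>UNIV. length (T j))"
        using sum_length_update[of T i "0 # u"] len by simp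
      show "count (mset ((T(i := 0 # u)) j)) 0 = 1" for j
        using less.prems(1)[of j] u0 by (auto simp: count_eq_zero_iff)
      show "sufficiently_covered ls (T(i := 0 # u)) x"
        if "\<And>j. x j \<in> set ((T(i := 0 # u)) j)" "x \<noteq> (\<lambda>j. 0)" for x
        using that by (intro covered) (simp_all add: u add_mset_commute[of 0 t])
    qed
    ultimately show ?thesis
      using divided_difference_recurrence_mset[of T i, OF u, of ls] by auto
  next
    case False
    have "T i = [0]" for i
    proof -
      obtain v where v: "mset (T i) = add_mset 0 (mset v)"
        using split0 by blast
      have "0 \<notin> set v"
        using less.prems(1)[of i] v by (auto simp: count_eq_zero_iff)
      moreover have "set v \<subseteq> set (T i)"
        using v by (metis mset.simps(2) set_mset_mset set_subset_Cons)
      ultimately have "v = []"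
        using False by (metis list.set_intros(1) neq_Nil_conv subsetD)
      then show ?thesis
        using v by simp
    qed
    then have "T = (\<lambda>i. [0])"
      by auto
    moreover have "(\<Prod>l\<leftarrow>ls. affine_value l (\<lambda>i. 0)) \<noteq> 0"
      using assms(3) by (auto simp: prod_list_zero_iff)
    ultimately show ?thesis
      using divided_difference_singletons[of ls "\<lambda>i. 0"] by simp
  qed
qed

section \<open>The covering bound\<close>

theorem theorem12:
  fixes S :: "'n::finite \<Rightarrow> 'a::field multiset"
    and Hs :: "('a ^ 'n) set list"
  assumes "\<And>i. 0 \<in># S i \<and> count (S i) 0 = 1"
    and "\<And>H. H \<in> set Hs \<Longrightarrow> affine_hyperplane H"
    and "\<And>s. s \<in> grid S - {0} \<Longrightarrow>
           int (cover_count Hs s) \<ge> int (total_mult S s) - int CARD('n) + 1"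
    and "\<And>H. H \<in> set Hs \<Longrightarrow> 0 \<notin> H"
  shows "int (length Hs) \<ge> (\<Sum>i\<in>UNIV. int (size (S i))) - int CARD('n)"
proof -
  have "\<forall>H \<in> set Hs. \<exists>l. \<forall>x. x \<in> H \<longleftrightarrow> affine_value l (($) x) = 0"
  proof
    fix H
    assume "H \<in> set Hs"
    then obtain a c where "H = {x. (\<Sum>i\<in>UNIV. a $ i * x $ i) + c = 0}"
      using assms(2) unfolding affine_hyperplane_def by blast
    then show "\<exists>l. \<forall>x. x \<in> H \<longleftrightarrow> affine_value l (($) x) = 0"
      by (intro exI[of _ "(($) a, c)"]) (simp add: affine_value_def)
  qed
  then obtain form where form:
    "\<And>H x. H \<in> set Hs \<Longrightarrow> x \<in> H \<longleftrightarrow> affine_value (form H) (($) x) = 0"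
    by metis
  define ls where "ls = map form Hs"
  have "\<forall>i. \<exists>v. mset v = S i"
    by (simp add: ex_mset)
  then obtain T where T: "\<And>i. mset (T i) = S i"
    by metis
  have "divided_difference ls T \<noteq> 0"
  proof (rule divided_difference_neq_0_if_punctured)
    show "count (mset (T i)) 0 = 1" for i
      using assms(1) T by simp
    show "affine_value l (\<lambda>i. 0) \<noteq> 0" if l: "l \<in> set ls" for l
    proof -
      obtain H where H: "H \<in> set Hs" "l = form H"
        using l unfolding ls_def by auto
      have "(($) (0 :: 'a ^ 'n)) = (\<lambda>i. 0)"
        by auto
      then show ?thesis
        using form[OF H(1), of 0] assms(4)[OF H(1)] H(2) by simp
    qed
  next
    fix x :: "'n \<Rightarrow> 'a"
    assume x: "\<And>i. x i \<in> set (T i)" "x \<noteq> (\<lambda>i. 0)"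
    define s where "s = vec_lambda x"
    have s: "($) s = x"
      by (auto simp: s_def)
    have "x i \<in># S i" for i
      using x(1)[of i] T[of i] by (metis set_mset_mset)
    moreover have "s \<noteq> 0"
      using x(2) s by auto
    ultimately have "s \<in> grid S - {0}"
      by (simp add: grid_def s)
    then have "total_mult S s + 1 \<le> cover_count Hs s + CARD('n)"
      using assms(3)[of s] by linarith
    moreover have "cover_count Hs s = length (filter (\<lambda>l. affine_value l x = 0) ls)"
    proof -
      have "filter (\<lambda>H. affine_value (form H) x = 0) Hs = filter (\<lambda>H. s \<in> H) Hs"
        by (rule filter_cong) (auto simp: form s)
      then show ?thesis
        by (simp add: cover_count_def ls_def filter_map o_def length_filter_conv_card)
    qed
    moreover have "total_mult S s = (\<Sum>i\<in>UNIV. count (mset (T i)) (x i))"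
      by (simp add: total_mult_def s T)
    ultimately show "sufficiently_covered ls T x"
      by (simp add: sufficiently_covered_def)
  qed
  then have "(\<Sum>i\<in>UNIV. length (T i)) \<le> length ls + CARD('n)"
    using divided_difference_low_degree[of ls T] by linarith
  moreover have "length (T i) = size (S i)" for i
    by (metis T size_mset)
  ultimately have "(\<Sum>i\<in>UNIV. size (S i)) \<le> length Hs + CARD('n)"
    by (simp add: ls_def)
  then have "int (\<Sum>i\<in>UNIV. size (S i)) \<le> int (length Hs + CARD('n))"
    by (simp only: of_nat_le_iff)
  then show ?thesis
    by simp
qed

end
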